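(* Let $(X,\tau)$ be a $T_1$-space and let $A\subseteq X$ with $A\notin\tau$. Consider the collection of all ideals of the form $\mathcal{I}_A$, obtained from arbitrary neighbourhood assignments on $A\setminus\operatorname{Int}(A)$; each of them generates in the ideal topological space $(X,\tau,\mathcal{I}_A)$ a topology $\tau^{*}$ which contains $A$. Then this collection has no minimal element with respect to inclusion; that is, for every ideal $\mathcal{I}_A$ in the collection there is an ideal in the collection which is properly contained in $\mathcal{I}_A$.
   Context: $\tau(x)=\{U\in\tau : x\in U\}$ is the family of open neighbourhoods of $x$; $\operatorname{Int}$ denotes interior in $\tau$. An ideal on $X$ is a nonempty family of subsets of $X$ closed under subsets and finite unions; the ideal generated by a family consists of all subsets of finite unions of members of the family. A neighbourhood assignment chooses, for each $x\in A\setminus\operatorname{Int}(A)$, some $U_x\in\tau(x)$; the corresponding ideal $\mathcal{I}_A$ is the ideal generated by $\{U_x\setminus A : x\in A\setminus\operatorname{Int}(A)\}$. For an ideal $\mathcal{I}$ on $X$ and $B\subseteq X$, put $B^{*}=\{x\in X : U\cap B\notin\mathcal{I}\text{ for every }U\in\tau(x)\}$; the topology $\tau^{*}$ is the one with closure operator $\operatorname{Cl}^{*}(B)=B\cup B^{*}$, and $\{V\setminus I : V\in\tau, I\in\mathcal{I}\}$ is a base of it. *)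

theory Defs
  imports "HOL-Analysis.Analysis"
begin

definition ideal_on :: "'a set \<Rightarrow> 'a set set \<Rightarrow> bool" where
  "ideal_on S \<I> \<longleftrightarrow> \<I> \<noteq> {} \<and> \<I> \<subseteq> Pow S \<and>
     (\<forall>E\<in>\<I>. \<forall>D. D \<subseteq> E \<longrightarrow> D \<in> \<I>) \<and> (\<forall>D\<in>\<I>. \<forall>E\<in>\<I>. D \<union> E \<in> \<I>)"

definition ideal_generated :: "'a set set \<Rightarrow> 'a set set" where
  "ideal_generated \<F> = {D. \<exists>\<G>. finite \<G> \<and> \<G> \<subseteq> \<F> \<and> D \<subseteq> \<Union>\<G>}"

lemma ideal_on_ideal_generated:
  assumes "\<F> \<subseteq> Pow S"
  shows "ideal_on S (ideal_generated \<F>)"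
  unfolding ideal_on_def
proof (intro conjI ballI allI impI)
  show "ideal_generated \<F> \<noteq> {}"
    by (auto simp: ideal_generated_def intro: exI[of _ "{}"])
  show "ideal_generated \<F> \<subseteq> Pow S"
    using assms by (fastforce simp: ideal_generated_def)
next
  fix E D assume "E \<in> ideal_generated \<F>" "D \<subseteq> E"
  then show "D \<in> ideal_generated \<F>"
    unfolding ideal_generated_def by blast
next
  fix D E assume "D \<in> ideal_generated \<F>" "E \<in> ideal_generated \<F>"
  then obtain \<G> \<H> where "finite \<G>" "\<G> \<subseteq> \<F>" "D \<subseteq> \<Union>\<G>" "finite \<H>" "\<H> \<subseteq> \<F>" "E \<subseteq> \<Union>\<H>"
    unfolding ideal_generated_def by blast
  then have "finite (\<G> \<union> \<H>)" "\<G> \<union> \<H> \<subseteq> \<F>" "D \<union> E \<subseteq> \<Union>(\<G> \<union> \<H>)"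
    by auto
  then show "D \<union> E \<in> ideal_generated \<F>"
    unfolding ideal_generated_def by blast
qed

text \<open>Only the values of the assignment on \<open>A - X interior_of A\<close> matter.\<close>

definition nbhd_assignment :: "'a topology \<Rightarrow> 'a set \<Rightarrow> ('a \<Rightarrow> 'a set) \<Rightarrow> bool" where
  "nbhd_assignment X A U \<longleftrightarrow> (\<forall>x \<in> A - X interior_of A. openin X (U x) \<and> x \<in> U x)"

definition assignment_ideal :: "'a topology \<Rightarrow> 'a set \<Rightarrow> ('a \<Rightarrow> 'a set) \<Rightarrow> 'a set set" where
  "assignment_ideal X A U = ideal_generated ((\<lambda>x. U x - A) ` (A - X interior_of A))"

definition assignment_ideals :: "'a topology \<Rightarrow> 'a set \<Rightarrow> 'a set set set" where
  "assignment_ideals X A = {assignment_ideal X A U | U. nbhd_assignment X A U}"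

lemma ideal_on_assignment_ideals:
  assumes "\<I> \<in> assignment_ideals X A"
  shows "ideal_on (topspace X) \<I>"
proof -
  obtain U where U: "nbhd_assignment X A U" and \<I>: "\<I> = assignment_ideal X A U"
    using assms by (auto simp: assignment_ideals_def)
  have "(\<lambda>x. U x - A) ` (A - X interior_of A) \<subseteq> Pow (topspace X)"
    using U openin_subset unfolding nbhd_assignment_def by blast
  then show ?thesis
    unfolding \<I> assignment_ideal_def by (rule ideal_on_ideal_generated)
qed

definition local_fun :: "'a topology \<Rightarrow> 'a set set \<Rightarrow> 'a set \<Rightarrow> 'a set" where
  "local_fun X \<I> B = {x \<in> topspace X. \<forall>U. openin X U \<and> x \<in> U \<longrightarrow> U \<inter> B \<notin> \<I>}"

definition star_closure :: "'a topology \<Rightarrow> 'a set set \<Rightarrow> 'a set \<Rightarrow> 'a set" where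
  "star_closure X \<I> B = B \<union> local_fun X \<I> B"

text \<open>The lemmas below show that, for an ideal, these sets do form a topology, that its closure
  operator is \<^const>\<open>star_closure\<close>, and that the sets \<open>V - E\<close> form a base of it.\<close>

definition star_topology :: "'a topology \<Rightarrow> 'a set set \<Rightarrow> 'a topology" where
  "star_topology X \<I> =
     topology (\<lambda>V. V \<subseteq> topspace X \<and> star_closure X \<I> (topspace X - V) = topspace X - V)"

lemma star_open_iff_base:
  assumes "ideal_on (topspace X) \<I>"
  shows "V \<subseteq> topspace X \<and> star_closure X \<I> (topspace X - V) = topspace X - V \<longleftrightarrow>
    (\<forall>x\<in>V. \<exists>U E. openin X U \<and> E \<in> \<I> \<and> x \<in> U - E \<and> U - E \<subseteq> V)" (is "?L \<longleftrightarrow> ?R")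
proof
  assume L: ?L
  show ?R
  proof
    fix x assume x: "x \<in> V"
    then have "x \<notin> local_fun X \<I> (topspace X - V)"
      using L unfolding star_closure_def by blast
    then obtain U where U: "openin X U" "x \<in> U" "U \<inter> (topspace X - V) \<in> \<I>"
      using L x unfolding local_fun_def by blast
    then have "U - (U \<inter> (topspace X - V)) \<subseteq> V" "x \<in> U - (U \<inter> (topspace X - V))"
      using x openin_subset by blast+
    with U show "\<exists>U E. openin X U \<and> E \<in> \<I> \<and> x \<in> U - E \<and> U - E \<subseteq> V"
      by blast
  qed
next
  assume R: ?R
  then have V: "V \<subseteq> topspace X"
    using openin_subset by blast
  have "x \<notin> local_fun X \<I> (topspace X - V)" if x: "x \<in> V" for x
  proof -
    obtain U E where UE: "openin X U" "E \<in> \<I>" "x \<in> U - E" "U - E \<subseteq> V"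
      using R x by blast
    then have "U \<inter> (topspace X - V) \<subseteq> E"
      by blast
    then have "U \<inter> (topspace X - V) \<in> \<I>"
      using assms UE(2) unfolding ideal_on_def by blast
    then show ?thesis
      using UE unfolding local_fun_def by blast
  qed
  then show ?L
    using V unfolding star_closure_def local_fun_def by blast
qed

lemma istopology_star:
  assumes "ideal_on (topspace X) \<I>"
  shows "istopology (\<lambda>V. V \<subseteq> topspace X \<and> star_closure X \<I> (topspace X - V) = topspace X - V)"
  unfolding star_open_iff_base[OF assms] istopology_def
proof (intro conjI allI impI ballI)
  fix S T x
  assume S: "\<forall>x\<in>S. \<exists>U E. openin X U \<and> E \<in> \<I> \<and> x \<in> U - E \<and> U - E \<subseteq> S"
    and T: "\<forall>x\<in>T. \<exists>U E. openin X U \<and> E \<in> \<I> \<and> x \<in> U - E \<and> U - E \<subseteq> T"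
    and x: "x \<in> S \<inter> T"
  obtain U E where UE: "openin X U" "E \<in> \<I>" "x \<in> U - E" "U - E \<subseteq> S"
    using S x by blast
  obtain V F where VF: "openin X V" "F \<in> \<I>" "x \<in> V - F" "V - F \<subseteq> T"
    using T x by blast
  have "openin X (U \<inter> V)" "E \<union> F \<in> \<I>" "x \<in> (U \<inter> V) - (E \<union> F)" "(U \<inter> V) - (E \<union> F) \<subseteq> S \<inter> T"
    using UE VF assms unfolding ideal_on_def by blast+
  then show "\<exists>U E. openin X U \<and> E \<in> \<I> \<and> x \<in> U - E \<and> U - E \<subseteq> S \<inter> T"
    by blast
next
  fix \<K> x
  assume K: "\<forall>K\<in>\<K>. \<forall>x\<in>K. \<exists>U E. openin X U \<and> E \<in> \<I> \<and> x \<in> U - E \<and> U - E \<subseteq> K"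
    and x: "x \<in> \<Union>\<K>"
  then obtain K where "K \<in> \<K>" "x \<in> K"
    by blast
  moreover then obtain U E where "openin X U" "E \<in> \<I>" "x \<in> U - E" "U - E \<subseteq> K"
    using K by blast
  ultimately show "\<exists>U E. openin X U \<and> E \<in> \<I> \<and> x \<in> U - E \<and> U - E \<subseteq> \<Union>\<K>"
    by blast
qed

lemma openin_star_topology:
  assumes "ideal_on (topspace X) \<I>"
  shows "openin (star_topology X \<I>) V \<longleftrightarrow>
    V \<subseteq> topspace X \<and> star_closure X \<I> (topspace X - V) = topspace X - V"
  unfolding star_topology_def using topology_inverse'[OF istopology_star[OF assms]] by simp

lemma openin_star_topology_base:
  assumes "ideal_on (topspace X) \<I>"
  shows "openin (star_topology X \<I>) V \<longleftrightarrow>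
    (\<forall>x\<in>V. \<exists>U E. openin X U \<and> E \<in> \<I> \<and> x \<in> U - E \<and> U - E \<subseteq> V)"
  unfolding openin_star_topology[OF assms] by (rule star_open_iff_base[OF assms])

lemma topspace_star_topology:
  assumes "ideal_on (topspace X) \<I>"
  shows "topspace (star_topology X \<I>) = topspace X"
proof
  show "topspace (star_topology X \<I>) \<subseteq> topspace X"
    using openin_star_topology[OF assms, of "topspace (star_topology X \<I>)"] by simp
  have "{} \<in> \<I>"
    using assms unfolding ideal_on_def by blast
  then have "openin (star_topology X \<I>) (topspace X)"
    unfolding openin_star_topology_base[OF assms] by fastforce
  then show "topspace X \<subseteq> topspace (star_topology X \<I>)"
    by (rule openin_subset)
qed

lemma closure_of_star_topology:
  assumes "ideal_on (topspace X) \<I>" and B: "B \<subseteq> topspace X"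
  shows "star_topology X \<I> closure_of B = star_closure X \<I> B"
proof -
  note base = openin_star_topology_base[OF assms(1)]
  have "x \<in> star_closure X \<I> B \<longleftrightarrow>
      (\<forall>T. x \<in> T \<and> openin (star_topology X \<I>) T \<longrightarrow> (\<exists>y\<in>B. y \<in> T))" (is "?L \<longleftrightarrow> ?R")
    if x: "x \<in> topspace X" for x
  proof
    assume L: ?L
    show ?R
    proof (intro allI impI, rule ccontr)
      fix T assume T: "x \<in> T \<and> openin (star_topology X \<I>) T" and no: "\<not> (\<exists>y\<in>B. y \<in> T)"
      obtain U E where UE: "openin X U" "E \<in> \<I>" "x \<in> U - E" "U - E \<subseteq> T"
        using T base by metis
      have "U \<inter> B \<subseteq> E"
        using UE(4) no by blast
      then have "U \<inter> B \<in> \<I>"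
        using assms(1) UE(2) unfolding ideal_on_def by blast
      then have "x \<in> B"
        using L UE unfolding star_closure_def local_fun_def by blast
      with T no show False by blast
    qed
  next
    assume R: ?R
    show ?L
    proof (rule ccontr)
      assume nL: "\<not> ?L"
      then obtain U where U: "openin X U" "x \<in> U" "U \<inter> B \<in> \<I>"
        using x unfolding star_closure_def local_fun_def by blast
      have "openin (star_topology X \<I>) (U - (U \<inter> B))"
        unfolding base using U by blast
      moreover have "x \<in> U - (U \<inter> B)"
        using U nL unfolding star_closure_def by blast
      ultimately obtain y where "y \<in> B" "y \<in> U - (U \<inter> B)"
        using R by meson
      then show False
        by blast
    qed
  qed
  moreover have "star_closure X \<I> B \<subseteq> topspace X"
    using B unfolding star_closure_def local_fun_def by blast
  ultimately show ?thesis
    unfolding closure_of_def topspace_star_topology[OF assms(1)] by auto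
qed

end

(* If U is an assignment and p lies in some U x0 - A, then deleting p from every U x yields,
   because points are closed and p is not in A, another assignment. Its ideal is contained in
   that of U, and no member of it contains p. *)
theory Submission
  imports Defs
begin

lemma ideal_generated_superset: "\<F> \<subseteq> ideal_generated \<F>"
proof
  fix D assume "D \<in> \<F>"
  then show "D \<in> ideal_generated \<F>"
    unfolding ideal_generated_def by (intro CollectI exI[of _ "{D}"]) auto
qed

text \<open>Reduces the question whether a point lies in some member of the ideal to the generators.
  This is how two assignment ideals are told apart below.\<close>

lemma Union_ideal_generated: "\<Union>(ideal_generated \<F>) = \<Union>\<F>"
proof
  show "\<Union>(ideal_generated \<F>) \<subseteq> \<Union>\<F>"
    unfolding ideal_generated_def by blast
qed (use ideal_generated_superset in \<open>rule Union_mono\<close>)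

lemma ideal_generated_mono_refine:
  assumes "\<And>x. x \<in> S \<Longrightarrow> f x \<subseteq> g x"
  shows "ideal_generated (f ` S) \<subseteq> ideal_generated (g ` S)"
proof
  fix D assume "D \<in> ideal_generated (f ` S)"
  then obtain \<G> where \<G>: "finite \<G>" "\<G> \<subseteq> f ` S" "D \<subseteq> \<Union>\<G>"
    unfolding ideal_generated_def by blast
  from finite_subset_image[OF \<G>(1,2)] obtain T where T: "T \<subseteq> S" "finite T" "\<G> = f ` T"
    by blast
  have "\<Union>(f ` T) \<subseteq> \<Union>(g ` T)"
    using assms T(1) by (intro UN_mono) auto
  then have "finite (g ` T)" "g ` T \<subseteq> g ` S" "D \<subseteq> \<Union>(g ` T)"
    using T \<G>(3) by auto
  then show "D \<in> ideal_generated (g ` S)"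
    unfolding ideal_generated_def by blast
qed

text \<open>An interior point has the interior minus \<open>{}\<close> as a basic set inside
  \<open>A\<close>. At any other \<open>x\<close> in \<open>A\<close>, removing the generator
  \<open>U x - A\<close> from \<open>U x\<close> leaves \<open>U x \<inter> A\<close>.\<close>

lemma openin_star_topology_assignment_ideals:
  assumes "\<I> \<in> assignment_ideals X A"
  shows "openin (star_topology X \<I>) A"
  unfolding openin_star_topology_base[OF ideal_on_assignment_ideals[OF assms]]
proof
  fix x assume x: "x \<in> A"
  obtain U where U: "nbhd_assignment X A U" and \<I>: "\<I> = assignment_ideal X A U"
    using assms by (auto simp: assignment_ideals_def)
  show "\<exists>V E. openin X V \<and> E \<in> \<I> \<and> x \<in> V - E \<and> V - E \<subseteq> A"
  proof (cases "x \<in> X interior_of A")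
    case True
    moreover have "{} \<in> \<I>"
      using ideal_on_assignment_ideals[OF assms] unfolding ideal_on_def by blast
    ultimately show ?thesis
      using openin_interior_of interior_of_subset by (metis Diff_empty)
  next
    case False
    with x have "openin X (U x)" "x \<in> U x - (U x - A)"
      using U by (auto simp: nbhd_assignment_def)
    moreover have "U x - A \<in> \<I>"
      unfolding \<I> assignment_ideal_def
      using x False by (intro subsetD[OF ideal_generated_superset] image_eqI[of _ _ x]) auto
    ultimately show ?thesis
      by blast
  qed
qed

lemma assignment_ideal_psubset:
  assumes "t1_space X" and "\<not> openin X A"
    and U: "nbhd_assignment X A U"
  shows "\<exists>V. nbhd_assignment X A V \<and> assignment_ideal X A V \<subset> assignment_ideal X A U"
proof -
  \<comment> \<open>As \<open>A\<close> is not open, it exceeds its interior, so there is at least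
    one generator.\<close>
  obtain x where x: "x \<in> A - X interior_of A"
    using assms(2) interior_of_subset[of X A] interior_of_eq[of X A] by blast
  \<comment> \<open>Otherwise the open set \<open>U x\<close> would make \<open>x\<close> an
    interior point of \<open>A\<close>.\<close>
  have "\<not> U x \<subseteq> A"
    using x U interior_of_maximal unfolding nbhd_assignment_def by blast
  then obtain p where p: "p \<in> U x" "p \<notin> A"
    by blast
  then have "p \<in> topspace X"
    using x U openin_subset unfolding nbhd_assignment_def by blast
  then have "closedin X {p}"
    using assms(1) by (rule closedin_t1_singleton[rotated])
  then have V: "nbhd_assignment X A (\<lambda>x. U x - {p})" (is "nbhd_assignment X A ?V")
    using U p(2) by (auto simp: nbhd_assignment_def)
  \<comment> \<open>The generator \<open>U x - A\<close> contains \<open>p\<close>, whereas every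
    generator from \<open>?V\<close> omits it; this makes the inclusion proper.\<close>
  have "p \<in> \<Union>(assignment_ideal X A U)" "p \<notin> \<Union>(assignment_ideal X A ?V)"
    using x p unfolding assignment_ideal_def Union_ideal_generated by auto
  moreover have "assignment_ideal X A ?V \<subseteq> assignment_ideal X A U"
    unfolding assignment_ideal_def by (rule ideal_generated_mono_refine) blast
  ultimately show ?thesis
    using V by blast
qed

theorem theorem1:
  fixes X :: "'a topology" and A :: "'a set"
  assumes "t1_space X"
    and "A \<subseteq> topspace X"
    and "\<not> openin X A"
  shows "(\<forall>\<I> \<in> assignment_ideals X A. openin (star_topology X \<I>) A) \<and>
         (\<forall>\<I> \<in> assignment_ideals X A. \<exists>\<J> \<in> assignment_ideals X A. \<J> \<subset> \<I>)"
proof (intro conjI ballI)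
  fix \<I> assume \<I>: "\<I> \<in> assignment_ideals X A"
  then show "openin (star_topology X \<I>) A"
    by (rule openin_star_topology_assignment_ideals)
  obtain U where U: "nbhd_assignment X A U" "\<I> = assignment_ideal X A U"
    using \<I> unfolding assignment_ideals_def by blast
  obtain V where "nbhd_assignment X A V" "assignment_ideal X A V \<subset> assignment_ideal X A U"
    using assignment_ideal_psubset[OF assms(1,3) U(1)] by blast
  then show "\<exists>\<J>\<in>assignment_ideals X A. \<J> \<subset> \<I>"
    unfolding U(2) assignment_ideals_def by blast
qed

end
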